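(* For $P$-almost all $\rho\in\Omega$ and $\eta^*_\rho$-almost all directions $[u_\rho],[v_\rho]\in\mathbb{R}P^1$ of (linearly independent) non-zero vectors $u_\rho,v_\rho\in\mathbb R^2$, the orbits $u_{p^k(\rho)}=DF_*^k(\tau_\rho)u_\rho$ and $v_{p^k(\rho)}=DF_*^k(\tau_\rho)v_\rho$, $k\ge0$, satisfy $$\lim_{k\to\infty}\frac1k\ln\frac{\sin\left(u_{p^k(\rho)},v_{p^k(\rho)}\right)}{\sin\left(u_\rho,v_\rho\right)}=0 .$$
   Context: $F_*$ is the Eckmann–Koch–Wittwer renormalization fixed point: a real analytic, exact symplectic twist diffeomorphism onto its image, defined on a suitable domain $D\subset\mathbb R^2$ with $(0,0)\in D$ (and extending holomorphically to a complex neighborhood), reversible ($T\circ F_*\circ T=F_*^{-1}$, $T(x,u)=(x,-u)$), with $F_*=\Lambda_*^{-1}\circ F_*\circ F_*\circ\Lambda_*$, $\Lambda_*(x,u)=(\lambda_*x,\mu_*u)$, $\lambda_*\in[-0.24887681,-0.24887376]$, $\mu_*\in[0.061107811,0.061112465]$. It is generated by a function $s^*$, i.e. $F_*:(x,-s^*(y,x))\mapsto(y,s^*(x,y))$, with $s^*(x,y)=\mu_*^{-1}s^*(z(x,y),\lambda_*y)$, where $z$ is the symmetric solution of $s^*(\lambda_*x,z)+s^*(\lambda_*y,z)=0$, normalized by $s^*(1,0)=0$, $\partial_1s^*(1,0)=1$, $z(1,0)=z(0,1)=1$, $\mu_*=\partial_1z(1,0)$, and with $\partial_1s^*$ symmetric.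 Put $\psi_0=\Lambda_*$, $\psi_1=F_*\circ\Lambda_*$ and $\Psi_w=\psi_{w_1}\circ\dots\circ\psi_{w_n}$ for $w\in\{0,1\}^n$. There are an ellipse $B_0\subset D$ with $T(B_0)=B_0$ and $B_1=F_*(B_0)\subset D$, disjoint, with $\psi_i(B_0\cup B_1)\subset B_i$; the level-$n$ pieces are $B^n_{wv}=\Psi_w(B_v)$, $w\in\{0,1\}^n$, $v\in\{0,1\}$, and their diameters tend to $0$ exponentially in $n$. $\Omega=\{0,1\}^{\mathbb N}$, $P$ is the $(1/2,1/2)$ Bernoulli measure on $\Omega$ and $p:\Omega\to\Omega$ is the dyadic adding machine (addition of $1$ to $\sum_kw_{k+1}2^k$). For $w\in\Omega$, $\tau_w=\Psi_w(\tau)$ (limit along the prefixes of $w$, $\tau=(0,0)$) is the unique point of $\bigcap_nB^n_{w_1\dots w_{n+1}}$, a point of the invariant Cantor set $\mathcal C_{F_*}$, and $F_*(\tau_w)=\tau_{p(w)}$. The projectivized derivative cocycle is $\Phi:\mathbb{R}P^1\times\Omega\to\mathbb{R}P^1\times\Omega$, $\Phi([v],w)=([DF_*(\tau_w)v],p(w))$. $\eta^*$ is a fixed ergodic $\Phi$-invariant Borel probability measure (it exists by Krylov–Bogolyubov); it disintegrates as $d\eta^*=d\eta^*_w\,dP$ with $\eta^*_w$ a probability measure on $\mathbb{R}P^1$. $(u,v)$ denotes the angle between vectors $u$ and $v$. *)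

theory Defs
  imports "HOL-Probability.Probability"
begin

section \<open>Analyticity and symplecticity for maps of the plane\<close>

definition real_analytic2_on :: "(real \<times> real \<Rightarrow> real \<times> real) \<Rightarrow> (real \<times> real) set \<Rightarrow> bool" where
  "real_analytic2_on f S \<longleftrightarrow>
     (\<forall>(a, b) \<in> S. \<exists>r>0. \<exists>c :: nat \<Rightarrow> nat \<Rightarrow> real \<times> real. \<forall>x y. dist (x, y) (a, b) < r \<longrightarrow>
        ((\<lambda>(i, j). ((x - a) ^ i * (y - b) ^ j) *\<^sub>R c i j) has_sum f (x, y)) UNIV)"

definition holomorphic2_on ::
    "(complex \<times> complex \<Rightarrow> complex \<times> complex) \<Rightarrow> (complex \<times> complex) set \<Rightarrow> bool" where
  "holomorphic2_on G U \<longleftrightarrow>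
     (\<forall>w\<in>U. \<exists>G'. (G has_derivative G') (at w) \<and>
        (\<forall>c h. G' (c * fst h, c * snd h) = (c * fst (G' h), c * snd (G' h))))"

definition complexify :: "real \<times> real \<Rightarrow> complex \<times> complex" where
  "complexify q = (of_real (fst q), of_real (snd q))"

definition extends_holomorphically ::
    "(real \<times> real \<Rightarrow> real \<times> real) \<Rightarrow> (real \<times> real) set \<Rightarrow> bool" where
  "extends_holomorphically F D \<longleftrightarrow>
     (\<exists>U G. open U \<and> complexify ` D \<subseteq> U \<and> holomorphic2_on G U \<and>
            (\<forall>q\<in>D. G (complexify q) = complexify (F q)))"

definition analytic_diffeo_onto_image ::
    "(real \<times> real \<Rightarrow> real \<times> real) \<Rightarrow> (real \<times> real) set \<Rightarrow> bool" where
  "analytic_diffeo_onto_image F D \<longleftrightarrow>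
     inj_on F D \<and> real_analytic2_on F D \<and>
     open (F ` D) \<and> real_analytic2_on (the_inv_into D F) (F ` D)"

abbreviation Deriv :: "(real \<times> real \<Rightarrow> real \<times> real) \<Rightarrow> real \<times> real \<Rightarrow> real \<times> real \<Rightarrow> real \<times> real" where
  "Deriv F q \<equiv> frechet_derivative F (at q)"

text \<open>The area form \<open>dx \<and> du\<close>, evaluated on two tangent vectors.\<close>
definition area_form :: "real \<times> real \<Rightarrow> real \<times> real \<Rightarrow> real" where
  "area_form h k = fst h * snd k - snd h * fst k"

text \<open>The function \<open>S\<close> is a primitive of \<open>F\<^sup>*\<alpha> - \<alpha>\<close>, where \<open>\<alpha> = u dx\<close>.\<close>
definition exact_symplectic_on ::
    "(real \<times> real \<Rightarrow> real \<times> real) \<Rightarrow> (real \<times> real) set \<Rightarrow> bool" where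
  "exact_symplectic_on F D \<longleftrightarrow>
     (\<forall>q\<in>D. \<forall>h k. area_form (Deriv F q h) (Deriv F q k) = area_form h k) \<and>
     (\<exists>S :: real \<times> real \<Rightarrow> real. \<forall>q\<in>D.
        (S has_derivative (\<lambda>h. snd (F q) * fst (Deriv F q h) - snd q * fst h)) (at q))"

definition twist_on :: "(real \<times> real \<Rightarrow> real \<times> real) \<Rightarrow> (real \<times> real) set \<Rightarrow> bool" where
  "twist_on F D \<longleftrightarrow> (\<forall>q\<in>D. fst (Deriv F q (0, 1)) \<noteq> 0)"


section \<open>The Eckmann--Koch--Wittwer fixed point\<close>

definition rev_T :: "real \<times> real \<Rightarrow> real \<times> real" where
  "rev_T q = (fst q, - snd q)"

definition Lam :: "real \<Rightarrow> real \<Rightarrow> real \<times> real \<Rightarrow> real \<times> real" where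
  "Lam lam mu q = (lam * fst q, mu * snd q)"

text \<open>
  \<open>D\<close> is the domain of the map \<open>F\<close>, and \<open>Ds\<close> the domain of its generating function \<open>s\<close> and
  of the midpoint function \<open>z\<close>; the values of these functions outside their domains are
  irrelevant. Accordingly, the identities \<open>T \<circ> F \<circ> T = F\<^sup>-\<^sup>1\<close> and \<open>\<Lambda> \<circ> F = F \<circ> F \<circ> \<Lambda>\<close> between
  partially defined maps are only required at points where both sides are defined.
\<close>
locale ekw_fixed_point =
  fixes D :: "(real \<times> real) set" and F :: "real \<times> real \<Rightarrow> real \<times> real"
    and lam mu :: real
    and Ds :: "(real \<times> real) set" and s z :: "real \<Rightarrow> real \<Rightarrow> real"
  assumes lam_bounds: "-0.24887681 \<le> lam" "lam \<le> -0.24887376"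
    and mu_bounds: "0.061107811 \<le> mu" "mu \<le> 0.061112465"
    and open_D: "open D"
    and zero_in_D: "(0, 0) \<in> D"
    and F_diffeo: "analytic_diffeo_onto_image F D"
    and F_holomorphic: "extends_holomorphically F D"
    and F_exact_symplectic: "exact_symplectic_on F D"
    and F_twist: "twist_on F D"
    and F_reversible:
      "\<And>q. q \<in> F ` D \<Longrightarrow> rev_T q \<in> D \<Longrightarrow> rev_T (F (rev_T q)) = the_inv_into D F q"
    and F_renormalization:
      "\<And>q. q \<in> D \<Longrightarrow> Lam lam mu q \<in> D \<Longrightarrow> F (Lam lam mu q) \<in> D \<Longrightarrow>
           F (F (Lam lam mu q)) = Lam lam mu (F q)"
    and open_Ds: "open Ds"
    and Ds_symmetric: "\<And>x y. (x, y) \<in> Ds \<Longrightarrow> (y, x) \<in> Ds"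
    and one_zero_in_Ds: "(1, 0) \<in> Ds"
    and F_generated:
      "\<And>q. q \<in> D \<Longrightarrow> \<exists>x y. (x, y) \<in> Ds \<and> q = (x, - s y x) \<and> F q = (y, s x y)"
    and s_differentiable: "\<And>x y. (x, y) \<in> Ds \<Longrightarrow> (\<lambda>t. s t y) differentiable at x"
    and s_deriv_symmetric:
      "\<And>x y. (x, y) \<in> Ds \<Longrightarrow> deriv (\<lambda>t. s t y) x = deriv (\<lambda>t. s t x) y"
    and z_in_Ds: "\<And>x y. (x, y) \<in> Ds \<Longrightarrow> (lam * x, z x y) \<in> Ds"
    and z_symmetric: "\<And>x y. (x, y) \<in> Ds \<Longrightarrow> z x y = z y x"
    and z_solution: "\<And>x y. (x, y) \<in> Ds \<Longrightarrow> s (lam * x) (z x y) + s (lam * y) (z x y) = 0"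
    and s_renormalization: "\<And>x y. (x, y) \<in> Ds \<Longrightarrow> s x y = inverse mu * s (z x y) (lam * y)"
    and s_normalized: "s 1 0 = 0" "((\<lambda>t. s t 0) has_real_derivative 1) (at 1)"
    and z_normalized: "z 1 0 = 1" "z 0 1 = 1" "((\<lambda>t. z t 0) has_real_derivative mu) (at 1)"


section \<open>The dyadic pieces and the Cantor set\<close>

text \<open>Binary digits are encoded as Booleans, with \<open>True\<close> for the digit \<open>1\<close>.\<close>

definition psi :: "(real \<times> real \<Rightarrow> real \<times> real) \<Rightarrow> real \<Rightarrow> real \<Rightarrow> bool \<Rightarrow> real \<times> real \<Rightarrow> real \<times> real" where
  "psi F lam mu i = (if i then F \<circ> Lam lam mu else Lam lam mu)"

fun Psi :: "(real \<times> real \<Rightarrow> real \<times> real) \<Rightarrow> real \<Rightarrow> real \<Rightarrow> bool list \<Rightarrow> real \<times> real \<Rightarrow> real \<times> real" where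
  "Psi F lam mu [] = id"
| "Psi F lam mu (i # w) = psi F lam mu i \<circ> Psi F lam mu w"

text \<open>Ellipses are solid and closed: nondegenerate affine images of the closed unit disc.\<close>
definition is_ellipse :: "(real \<times> real) set \<Rightarrow> bool" where
  "is_ellipse B \<longleftrightarrow>
     (\<exists>c A. linear A \<and> bij A \<and> B = (\<lambda>h. c + A h) ` cball (0 :: real \<times> real) 1)"

definition base_piece ::
    "(real \<times> real \<Rightarrow> real \<times> real) \<Rightarrow> (real \<times> real) set \<Rightarrow> bool \<Rightarrow> (real \<times> real) set" where
  "base_piece F B0 v = (if v then F ` B0 else B0)"

locale ekw_pieces = ekw_fixed_point D F lam mu Ds s z
  for D F lam mu Ds s z +
  fixes B0 :: "(real \<times> real) set"
  assumes B0_ellipse: "is_ellipse B0"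
    and B0_symmetric: "rev_T ` B0 = B0"
    and pieces_in_D: "base_piece F B0 v \<subseteq> D"
    and pieces_disjoint: "base_piece F B0 False \<inter> base_piece F B0 True = {}"
    and psi_pieces:
      "psi F lam mu i ` (base_piece F B0 False \<union> base_piece F B0 True) \<subseteq> base_piece F B0 i"
    and pieces_shrink:
      "\<exists>C \<theta>. 0 < \<theta> \<and> \<theta> < 1 \<and>
         (\<forall>w v. diameter (Psi F lam mu w ` base_piece F B0 v) \<le> C * \<theta> ^ length w)"

definition tau ::
    "(real \<times> real \<Rightarrow> real \<times> real) \<Rightarrow> real \<Rightarrow> real \<Rightarrow> (nat \<Rightarrow> bool) \<Rightarrow> real \<times> real" where
  "tau F lam mu w = lim (\<lambda>n. Psi F lam mu (map w [0..<n]) (0, 0))"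


section \<open>The adding machine and the Bernoulli measure\<close>

text \<open>Adding \<open>1\<close> flips a digit exactly when the carry reaches it, that is, when all lower
  digits are \<open>1\<close>.\<close>
definition adding_machine :: "(nat \<Rightarrow> bool) \<Rightarrow> nat \<Rightarrow> bool" where
  "adding_machine w = (\<lambda>k. w k \<noteq> (\<forall>j<k. w j))"

lemma adding_machine_sum:
  "(\<Sum>k<n. of_bool (adding_machine w k) * 2 ^ k :: nat) + (if \<forall>j<n. w j then 2 ^ n else 0)
     = (\<Sum>k<n. of_bool (w k) * 2 ^ k) + 1"
proof (induction n)
  case (Suc n)
  have "adding_machine w n = (w n \<noteq> (\<forall>j<n. w j))"
    by (simp add: adding_machine_def)
  moreover have "(\<forall>j<Suc n. w j) = ((\<forall>j<n. w j) \<and> w n)"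
    by (auto simp: less_Suc_eq)
  ultimately show ?case
    using Suc by (cases "\<forall>j<n. w j"; cases "w n") (simp_all only: sum.lessThan_Suc, simp_all)
qed simp

lemma adding_machine_cong:
  "(\<Sum>k<n. of_bool (adding_machine w k) * 2 ^ k :: nat) mod 2 ^ n
     = ((\<Sum>k<n. of_bool (w k) * 2 ^ k) + 1) mod 2 ^ n"
  by (subst adding_machine_sum [symmetric]) auto

definition bernoulli_measure :: "(nat \<Rightarrow> bool) measure" where
  "bernoulli_measure = PiM UNIV (\<lambda>_. measure_pmf (bernoulli_pmf (1 / 2)))"


section \<open>The projectivized derivative cocycle\<close>

text \<open>Points of the projective line are the one-dimensional subspaces of the plane, with
  \<open>[v] = span {v}\<close>; its topology is the quotient topology.\<close>

definition RP1 :: "(real \<times> real) set set" where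
  "RP1 = {span {v} | v. v \<noteq> 0}"

definition RP1_borel :: "(real \<times> real) set measure" where
  "RP1_borel = sigma RP1 {U. U \<subseteq> RP1 \<and> open {v. v \<noteq> 0 \<and> span {v} \<in> U}}"

definition Phi ::
    "(real \<times> real \<Rightarrow> real \<times> real) \<Rightarrow> real \<Rightarrow> real \<Rightarrow>
     (real \<times> real) set \<times> (nat \<Rightarrow> bool) \<Rightarrow> (real \<times> real) set \<times> (nat \<Rightarrow> bool)" where
  "Phi F lam mu = (\<lambda>(l, w). (Deriv F (tau F lam mu w) ` l, adding_machine w))"

definition ergodic_invariant :: "'a measure \<Rightarrow> ('a \<Rightarrow> 'a) \<Rightarrow> bool" where
  "ergodic_invariant M f \<longleftrightarrow>
     prob_space M \<and> f \<in> measurable M M \<and> distr M M f = M \<and>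
     (\<forall>A \<in> sets M. f -` A \<inter> space M = A \<longrightarrow> measure M A = 0 \<or> measure M A = 1)"

definition disintegration ::
    "((real \<times> real) set \<times> (nat \<Rightarrow> bool)) measure \<Rightarrow>
     ((nat \<Rightarrow> bool) \<Rightarrow> (real \<times> real) set measure) \<Rightarrow> bool" where
  "disintegration eta etaw \<longleftrightarrow>
     etaw \<in> measurable bernoulli_measure (prob_algebra RP1_borel) \<and>
     (\<forall>A \<in> sets eta. emeasure eta A =
        (\<integral>\<^sup>+ w. emeasure (etaw w) {l \<in> RP1. (l, w) \<in> A} \<partial>bernoulli_measure))"

definition angle :: "real \<times> real \<Rightarrow> real \<times> real \<Rightarrow> real" where
  "angle u v = arccos (inner u v / (norm u * norm v))"

end

theory Submission
  imports Defs "HOL-Complex_Analysis.Cauchy_Integral_Formula"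
begin

text \<open>
  The limit is \<open>0\<close> at every point of the Cantor set and for every pair of independent directions.

  Since \<open>DF\<close> has determinant \<open>1\<close>, the parallelogram spanned by the two iterated vectors keeps its
  area, and the sine of an angle is this area divided by the product of the two lengths. The ratio
  of sines is therefore \<open>|u| |v| / (|u\<^sub>k| |v\<^sub>k|)\<close>, and area preservation also turns an
  upper bound on the growth of all vectors into a lower bound. So it suffices that \<open>\<parallel>DF\<^sup>k(\<tau> w)\<parallel>\<close>
  grows subexponentially, uniformly in \<open>w\<close> (\<open>growth_rate_subexponential\<close>).

  This is a consequence of the renormalization equation \<open>F \<circ> F \<circ> \<Lambda> = \<Lambda> \<circ> F\<close>. Along the Cantor set it
  gives \<open>DF\<^sup>2\<^sup>m(\<Lambda> q) = \<Lambda> DF\<^sup>m(q) \<Lambda>\<^sup>-\<^sup>1\<close> (\<open>Deriv_even_funpow_Lam\<close>): near \<open>\<Lambda> q\<close> the same derivative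
  takes twice as long to build up, and the conjugation by \<open>\<Lambda>\<close> costs only a constant factor. As every
  point of the Cantor set reaches the image of \<open>\<Lambda>\<close> within one iterate, an exponential rate \<open>a\<close>
  that is valid on the whole Cantor set can be replaced by \<open>a / 2\<close>
  (\<open>growth_rate_halve\<close>). Some finite rate exists because \<open>DF\<close> is bounded on compact sets; halving it
  repeatedly gives arbitrarily small rates.

  That the orbits stay in the Cantor set is the relation \<open>F(\<tau> w) = \<tau>(p w)\<close> with \<open>p\<close> the adding
  machine (\<open>F_tau\<close>), which follows from the same equation because \<open>\<Lambda>\<close> is a contraction.
\<close>

section \<open>Area and angle in the plane\<close>

lemma area_form_square:
  "(area_form u v)\<^sup>2 = (norm u * norm v)\<^sup>2 - (inner u v)\<^sup>2"
proof -
  obtain a b c d where uv: "u = (a, b)" "v = (c, d)" by (cases u, cases v)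
  have "(norm u)\<^sup>2 = a\<^sup>2 + b\<^sup>2" "(norm v)\<^sup>2 = c\<^sup>2 + d\<^sup>2"
    by (simp_all add: uv norm_Pair)
  then show ?thesis
    by (simp add: uv area_form_def power_mult_distrib inner_prod_def power2_eq_square algebra_simps)
qed

lemma abs_area_form_le: "\<bar>area_form u v\<bar> \<le> norm u * norm v"
  by (rule power2_le_imp_le) (auto simp: area_form_square)

lemma sin_angle:
  assumes "u \<noteq> 0" "v \<noteq> 0"
  shows "sin (angle u v) = \<bar>area_form u v\<bar> / (norm u * norm v)"
proof -
  define t where "t = inner u v / (norm u * norm v)"
  have "\<bar>t\<bar> \<le> 1"
    using Cauchy_Schwarz_ineq2[of u v] assms by (simp add: t_def abs_div)
  then have "sin (arccos t) = sqrt (1 - t\<^sup>2)" by (intro sin_arccos) auto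
  also have "1 - t\<^sup>2 = (area_form u v / (norm u * norm v))\<^sup>2"
    using assms by (simp add: t_def power_divide area_form_square diff_divide_distrib)
  finally show ?thesis by (simp add: angle_def t_def abs_div)
qed

lemma independent_imp_area_form_nonzero:
  assumes "u \<noteq> v" "independent {u, v}"
  shows "area_form u v \<noteq> 0"
proof
  assume 0: "area_form u v = 0"
  have v0: "v \<noteq> 0" and u: "u \<notin> span {v}"
    using assms by (auto simp: independent_insert)
  have "u = (inner u v / inner v v) *\<^sub>R v"
  proof -
    obtain a b c d where uv: "u = (a, b)" "v = (c, d)" by (cases u, cases v)
    have e: "a * d = c * b" using 0 by (simp add: uv area_form_def)
    have p: "c * c + d * d \<noteq> 0" using v0 by (auto simp: uv zero_prod_def sum_squares_eq_zero_iff)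
    have "a * (c * c + d * d) = (a * c + b * d) * c"
      using e by algebra
    moreover have "b * (c * c + d * d) = (a * c + b * d) * d"
      using e by algebra
    ultimately show ?thesis using p by (simp add: uv inner_prod_def field_simps)
  qed
  then show False using u by (metis span_breakdown_eq span_empty span_mul span_base singletonI)
qed

section \<open>Derivative bounds from the holomorphic extension\<close>

lemma norm_complexify: "norm (complexify h) = norm h"
  by (cases h) (simp add: complexify_def norm_Pair)

lemma bounded_linear_complexify: "bounded_linear complexify"
  unfolding complexify_def
  by (intro bounded_linear_Pair bounded_linear_compose[OF bounded_linear_of_real]
      bounded_linear_fst bounded_linear_snd)

definition real_part2 :: "complex \<times> complex \<Rightarrow> real \<times> real" where
  "real_part2 p = (Re (fst p), Re (snd p))"

lemma real_part2_complexify [simp]: "real_part2 (complexify q) = q"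
  by (simp add: real_part2_def complexify_def)

lemma bounded_linear_real_part2: "bounded_linear real_part2"
  unfolding real_part2_def
  by (intro bounded_linear_Pair bounded_linear_compose[OF bounded_linear_Re]
      bounded_linear_fst bounded_linear_snd)

text \<open>
  Cauchy's estimate on the complex disc \<open>w + \<zeta> e\<close>, \<open>|\<zeta>| \<le> r\<close>. The map \<open>\<pi>\<close> stands for either coordinate
  projection, which makes the function on the disc scalar-valued.
\<close>
lemma holomorphic2_directional_bound:
  assumes hol: "holomorphic2_on G U" and sub: "cball w r \<subseteq> U" and r: "r > 0"
    and M: "\<And>p. p \<in> cball w r \<Longrightarrow> norm (G p) \<le> M"
    and e: "norm e = 1"
    and G': "(G has_derivative G') (at w)"
    and proj: "bounded_linear \<pi>" "\<And>c p. \<pi> (c * fst p, c * snd p) = c * \<pi> p"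
      "\<And>p. norm (\<pi> p) \<le> norm p"
  shows "norm (\<pi> (G' e) :: complex) \<le> M / r"
proof -
  define line where "line \<zeta> = w + (\<zeta> * fst e, \<zeta> * snd e)" for \<zeta> :: complex
  define f where "f \<zeta> = \<pi> (G (line \<zeta>))" for \<zeta>
  have line_norm: "norm (\<zeta> * fst e, \<zeta> * snd e) = norm \<zeta>" for \<zeta> :: complex
  proof -
    have "norm (\<zeta> * fst e, \<zeta> * snd e) = norm \<zeta> * norm e"
      by (cases e) (simp add: norm_Pair norm_mult power_mult_distrib
          distrib_left[symmetric] real_sqrt_mult)
    then show ?thesis by (simp add: e)
  qed
  have line_in: "line \<zeta> \<in> cball w r" if "\<zeta> \<in> cball 0 r" for \<zeta>
    using that line_norm[of \<zeta>] norm_minus_cancel[of "(\<zeta> * fst e, \<zeta> * snd e)"]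
    by (simp add: line_def dist_norm)
  have line_deriv: "(line has_derivative (\<lambda>h. (h * fst e, h * snd e))) (at \<zeta>)" for \<zeta>
    unfolding line_def by (auto intro!: derivative_eq_intros)
  have f_deriv: "(f has_field_derivative \<pi> (H e)) (at \<zeta>)"
    if H: "(G has_derivative H) (at (line \<zeta>))"
      and lin: "\<And>c h. H (c * fst h, c * snd h) = (c * fst (H h), c * snd (H h))" for \<zeta> H
  proof -
    have "((\<lambda>\<zeta>. \<pi> (G (line \<zeta>))) has_derivative (\<lambda>h. \<pi> (H (h * fst e, h * snd e)))) (at \<zeta>)"
      by (rule bounded_linear.has_derivative[OF proj(1)])
        (rule has_derivative_compose[OF line_deriv H])
    then show ?thesis
      unfolding has_field_derivative_def f_def by (simp add: lin proj(2) mult.commute mult_commute_abs)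
  qed
  have ex: "\<exists>H. (G has_derivative H) (at (line \<zeta>)) \<and>
      (\<forall>c h. H (c * fst h, c * snd h) = (c * fst (H h), c * snd (H h)))"
    if "\<zeta> \<in> cball 0 r" for \<zeta>
    using hol line_in[OF that] sub unfolding holomorphic2_on_def by blast
  have hf: "f holomorphic_on cball 0 r"
    unfolding holomorphic_on_def field_differentiable_def
    using ex f_deriv by (meson has_field_derivative_at_within)
  have "norm ((deriv ^^ 1) f 0) \<le> fact 1 * M / r ^ 1"
  proof (rule Cauchy_inequality)
    show "f holomorphic_on ball 0 r" "continuous_on (cball 0 r) f"
      using hf holomorphic_on_subset[OF hf ball_subset_cball] holomorphic_on_imp_continuous_on by auto
    show "norm (f x) \<le> M" if "norm (0 - x) = r" for x
      using M[OF line_in[of x]] that proj(3)[of "G (line x)"] by (simp add: f_def)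
  qed (fact r)
  moreover have "deriv f 0 = \<pi> (G' e)"
  proof -
    have [simp]: "line 0 = w" by (simp add: line_def zero_prod_def)
    obtain H where H: "(G has_derivative H) (at w)"
      "\<And>c h. H (c * fst h, c * snd h) = (c * fst (H h), c * snd (H h))"
      using ex[of 0] r by auto
    have "H = G'" using H(1) G' has_derivative_unique by blast
    then show ?thesis using f_deriv[of H 0] H by (simp add: DERIV_imp_deriv)
  qed
  ultimately show ?thesis by simp
qed

text \<open>
  The real derivative is read off from the complex one. This is what ensures that
  \<^term>\<open>Deriv F q\<close> is a genuine derivative on \<open>D\<close>.
\<close>
lemma extends_holomorphically_has_derivative:
  assumes "open D" "q \<in> D" and GF: "\<forall>q\<in>D. G (complexify q) = complexify (F q)"
    and G': "(G has_derivative G') (at (complexify q))"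
  shows "(F has_derivative (\<lambda>h. real_part2 (G' (complexify h)))) (at q)"
proof -
  have "((\<lambda>q. real_part2 (G (complexify q))) has_derivative
      (\<lambda>h. real_part2 (G' (complexify h)))) (at q)"
    by (rule bounded_linear.has_derivative[OF bounded_linear_real_part2]
        has_derivative_compose[OF bounded_linear_imp_has_derivative[OF bounded_linear_complexify] G'])+
  then show ?thesis
    by (rule has_derivative_transform_within_open[OF _ assms(1,2)]) (simp add: GF)
qed

lemma extends_holomorphically_differentiable:
  assumes "extends_holomorphically F D" "open D" "q \<in> D"
  shows "F differentiable (at q)"
proof -
  obtain U G where UG: "complexify ` D \<subseteq> U" "holomorphic2_on G U"
    "\<forall>q\<in>D. G (complexify q) = complexify (F q)"
    using assms(1) unfolding extends_holomorphically_def by blast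
  obtain G' where "(G has_derivative G') (at (complexify q))"
    using UG(1,2) assms(3) unfolding holomorphic2_on_def by blast
  from extends_holomorphically_has_derivative[OF assms(2,3) UG(3) this]
  show ?thesis by (rule differentiableI)
qed

text \<open>
  A closed complex neighbourhood of \<open>K\<close> of some radius \<open>r\<close> is compact and lies in the domain of the
  extension, so the extension is bounded there by some \<open>M\<close>. Cauchy's estimate on discs of radius \<open>r\<close>
  then bounds both components of the derivative by \<open>M / r\<close>, uniformly on \<open>K\<close>. The bound is taken to be
  at least \<open>1\<close> so that its powers can absorb extra iterates.
\<close>
lemma extends_holomorphically_Deriv_bounded:
  assumes ext: "extends_holomorphically F D" and D: "open D" and K: "compact K" "K \<subseteq> D"
  obtains L where "L \<ge> 1" "\<And>q h. q \<in> K \<Longrightarrow> norm (Deriv F q h) \<le> L * norm h"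
proof -
  obtain U G where U: "open U" "complexify ` D \<subseteq> U" and hol: "holomorphic2_on G U"
    and GF: "\<forall>q\<in>D. G (complexify q) = complexify (F q)"
    using ext unfolding extends_holomorphically_def by blast
  define K' where "K' = complexify ` K"
  have K': "compact K'"
    unfolding K'_def
    by (intro compact_continuous_image linear_continuous_on bounded_linear_complexify K)
  obtain r where r: "r > 0" "(\<Union>x\<in>K'. cball x r) \<subseteq> U"
    using compact_subset_open_imp_cball_epsilon_subset[OF K' U(1)] U(2) K(2) K'_def by blast
  define N where "N = (\<Union>x\<in>K'. cball x r)"
  have "compact N"
    unfolding N_def using K' compact_minkowski_sum_cball by blast
  moreover have "continuous_on N G"
    using hol r(2) unfolding N_def holomorphic2_on_def
    by (intro continuous_at_imp_continuous_on) (blast intro: has_derivative_continuous)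
  ultimately have "bounded (G ` N)" using compact_continuous_image compact_imp_bounded by blast
  then obtain M where M: "M > 0" "\<And>p. p \<in> N \<Longrightarrow> norm (G p) \<le> M"
    unfolding bounded_pos by auto
  have bound: "norm (Deriv F q h) \<le> (2 * M / r) * norm h" if q: "q \<in> K" for q h
  proof -
    obtain G' where G': "(G has_derivative G') (at (complexify q))"
      using hol q U(2) K(2) unfolding holomorphic2_on_def by blast
    have D': "(F has_derivative (\<lambda>h. real_part2 (G' (complexify h)))) (at q)"
      using extends_holomorphically_has_derivative[OF D _ GF G'] q K(2) by blast
    then have DF: "Deriv F q = (\<lambda>h. real_part2 (G' (complexify h)))"
      using frechet_derivative_at by metis
    have lin: "linear (Deriv F q)"
      using D' unfolding DF has_derivative_def using bounded_linear.linear by blast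
    have sub: "cball (complexify q) r \<subseteq> N" using q by (auto simp: N_def K'_def)
    have unit: "norm (Deriv F q e) \<le> 2 * M / r" if e: "norm e = 1" for e
    proof -
      have "norm (fst (G' (complexify e))) \<le> M / r"
        by (rule holomorphic2_directional_bound[OF hol _ r(1) _ _ G'])
          (use sub r(2) M(2) e in \<open>auto simp: N_def[symmetric] norm_complexify norm_fst_le intro: bounded_linear_fst\<close>)
      moreover have "norm (snd (G' (complexify e))) \<le> M / r"
        by (rule holomorphic2_directional_bound[OF hol _ r(1) _ _ G'])
          (use sub r(2) M(2) e in \<open>auto simp: N_def[symmetric] norm_complexify norm_snd_le intro: bounded_linear_snd\<close>)
      moreover have "norm (Deriv F q e) \<le> \<bar>Re (fst (G' (complexify e)))\<bar> + \<bar>Re (snd (G' (complexify e)))\<bar>"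
        using norm_Pair_le[of "Re (fst (G' (complexify e)))" "Re (snd (G' (complexify e)))"]
        by (simp add: DF real_part2_def)
      ultimately show ?thesis
        using abs_Re_le_cmod[of "fst (G' (complexify e))"] abs_Re_le_cmod[of "snd (G' (complexify e))"]
        by (simp add: add_divide_distrib[symmetric])
    qed
    show ?thesis
    proof (cases "h = 0")
      case True
      then show ?thesis using linear_0[OF lin] by simp
    next
      case False
      have "Deriv F q h = norm h *\<^sub>R Deriv F q (h /\<^sub>R norm h)"
        using False by (simp add: linear_cmul[OF lin, symmetric])
      then have "norm (Deriv F q h) = norm h * norm (Deriv F q (h /\<^sub>R norm h))" by simp
      also have "\<dots> \<le> norm h * (2 * M / r)"
        using unit[of "h /\<^sub>R norm h"] False by (intro mult_left_mono) auto
      finally show ?thesis by (simp add: mult.commute)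
    qed
  qed
  show thesis
  proof (rule that[of "max 1 (2 * M / r)"])
    show "norm (Deriv F q h) \<le> max 1 (2 * M / r) * norm h" if "q \<in> K" for q h
      using bound[OF that, of h] mult_right_mono[of "2 * M / r" "max 1 (2 * M / r)" "norm h"] by simp
  qed simp
qed


section \<open>The pieces and the points of the Cantor set\<close>

context ekw_pieces
begin

abbreviation \<Lambda> :: "real \<times> real \<Rightarrow> real \<times> real" where "\<Lambda> \<equiv> Lam lam mu"
abbreviation \<psi> :: "bool \<Rightarrow> real \<times> real \<Rightarrow> real \<times> real" where "\<psi> \<equiv> psi F lam mu"
abbreviation \<Psi> :: "bool list \<Rightarrow> real \<times> real \<Rightarrow> real \<times> real" where "\<Psi> \<equiv> Psi F lam mu"
abbreviation B :: "bool \<Rightarrow> (real \<times> real) set" where "B \<equiv> base_piece F B0"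
abbreviation \<tau> :: "(nat \<Rightarrow> bool) \<Rightarrow> real \<times> real" where "\<tau> \<equiv> tau F lam mu"

lemma lam_mu_le: "\<bar>lam\<bar> \<le> 1 / 4" "\<bar>mu\<bar> \<le> 1 / 4"
  using lam_bounds mu_bounds by auto

lemma mu_pos: "mu > 0" and mu_le_lam: "mu \<le> \<bar>lam\<bar>"
  using lam_bounds mu_bounds by auto

lemma linear_Lam: "bounded_linear \<Lambda>"
  unfolding Lam_def
  by (intro bounded_linear_Pair bounded_linear_compose[OF bounded_linear_mult_right]
      bounded_linear_fst bounded_linear_snd)

lemma norm_Lam_le: "norm (\<Lambda> h) \<le> (1 / 4) * norm h"
proof -
  have "(lam * fst h)\<^sup>2 + (mu * snd h)\<^sup>2 \<le> (1/4)\<^sup>2 * (fst h)\<^sup>2 + (1/4)\<^sup>2 * (snd h)\<^sup>2"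
    unfolding power_mult_distrib using lam_mu_le
    by (intro add_mono mult_right_mono power2_le_iff_abs_le[THEN iffD2]) auto
  also have "\<dots> = ((1/4) * norm h)\<^sup>2"
    by (cases h) (simp add: norm_Pair power_mult_distrib power_divide algebra_simps)
  finally show ?thesis
    unfolding Lam_def norm_Pair by (intro real_le_lsqrt) auto
qed

lemma norm_Lam_ge: "mu * norm h \<le> norm (\<Lambda> h)"
proof -
  have "(mu * norm h)\<^sup>2 = mu\<^sup>2 * (fst h)\<^sup>2 + mu\<^sup>2 * (snd h)\<^sup>2"
    by (cases h) (simp add: norm_Pair power_mult_distrib algebra_simps)
  also have "\<dots> \<le> (lam * fst h)\<^sup>2 + (mu * snd h)\<^sup>2"
    unfolding power_mult_distrib using mu_le_lam mu_pos
    by (intro add_mono mult_right_mono abs_le_square_iff[THEN iffD1]) auto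
  finally show ?thesis
    unfolding Lam_def norm_Pair by (intro real_le_rsqrt) auto
qed

lemma surj_Lam: obtains h' where "h = \<Lambda> h'"
proof
  show "h = \<Lambda> (fst h / lam, snd h / mu)"
    using lam_bounds mu_bounds by (simp add: Lam_def)
qed

lemma F_has_derivative: "q \<in> D \<Longrightarrow> (F has_derivative Deriv F q) (at q)"
  using extends_holomorphically_differentiable[OF F_holomorphic open_D]
  by (simp add: frechet_derivative_works)

lemma continuous_F: "S \<subseteq> D \<Longrightarrow> continuous_on S F"
  by (meson F_has_derivative continuous_at_imp_continuous_on has_derivative_continuous subsetD)

lemma compact_piece: "compact (B v)"
proof -
  obtain c A where A: "linear A" "B0 = (\<lambda>h. c + A h) ` cball (0 :: real \<times> real) 1"
    using B0_ellipse unfolding is_ellipse_def by blast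
  have "compact B0"
    unfolding A(2)
    by (intro compact_continuous_image continuous_intros linear_continuous_on
        linear_conv_bounded_linear[THEN iffD1] A compact_cball)
  moreover have "B0 \<subseteq> D" using pieces_in_D[of False] by (simp add: base_piece_def)
  ultimately show ?thesis
    by (auto simp: base_piece_def intro!: compact_continuous_image continuous_F)
qed

definition base_union :: "(real \<times> real) set" where "base_union = B False \<union> B True"

lemma piece_subset_base_union: "B v \<subseteq> base_union"
  by (cases v) (auto simp: base_union_def)

lemma compact_base_union: "compact base_union"
  unfolding base_union_def by (intro compact_Un compact_piece)

lemma base_union_subset_D: "base_union \<subseteq> D"
  using pieces_in_D by (auto simp: base_union_def)

lemma psi_in_piece: "q \<in> base_union \<Longrightarrow> \<psi> i q \<in> B i"
  using psi_pieces[of i] by (auto simp: base_union_def)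

lemma Lam_in_piece: "q \<in> base_union \<Longrightarrow> \<Lambda> q \<in> B False"
  using psi_in_piece[of q False] by (simp add: psi_def)

lemma Psi_in_base_union: "q \<in> base_union \<Longrightarrow> \<Psi> w q \<in> base_union"
proof (induction w)
  case (Cons i w)
  have "\<psi> i (\<Psi> w q) \<in> B i" using Cons by (intro psi_in_piece)
  then show ?case using piece_subset_base_union by auto
qed simp

lemma continuous_on_psi: "continuous_on base_union (\<psi> i)"
proof -
  have L: "continuous_on base_union \<Lambda>" using linear_Lam by (rule linear_continuous_on)
  moreover have "continuous_on (\<Lambda> ` base_union) F"
    using Lam_in_piece pieces_in_D by (intro continuous_F) blast
  ultimately show ?thesis
    by (simp add: psi_def continuous_on_compose del: o_apply)
qed

lemma continuous_on_Psi: "continuous_on base_union (\<Psi> w)"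
proof (induction w)
  case (Cons i w)
  have "continuous_on (\<Psi> w ` base_union) (\<psi> i)"
    using Psi_in_base_union by (intro continuous_on_subset[OF continuous_on_psi]) blast
  with Cons show ?case by (simp only: Psi.simps continuous_on_compose)
qed (simp add: id_def)

lemma Psi_append: "\<Psi> (v @ w) = \<Psi> v \<circ> \<Psi> w"
  by (induction v) (auto simp: comp_assoc)

text \<open>
  The contraction \<open>\<Lambda>\<close> maps the closed set \<open>B0\<close> into itself, so its fixed point lies in \<open>B0\<close>.
\<close>
lemma zero_in_base_union: "(0, 0) \<in> base_union"
proof -
  have "B0 \<noteq> {}" using B0_ellipse by (auto simp: is_ellipse_def)
  then obtain q where q: "q \<in> B0" by blast
  have orbit: "(\<Lambda> ^^ n) q \<in> B0 \<and> norm ((\<Lambda> ^^ n) q) \<le> (1/4) ^ n * norm q" for n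
  proof (induction n)
    case (Suc n)
    have "\<Lambda> ((\<Lambda> ^^ n) q) \<in> B0"
      using Suc Lam_in_piece[of "(\<Lambda> ^^ n) q"] by (auto simp: base_piece_def base_union_def)
    moreover have "norm (\<Lambda> ((\<Lambda> ^^ n) q)) \<le> (1/4) ^ Suc n * norm q"
      using norm_Lam_le[of "(\<Lambda> ^^ n) q"] Suc by simp
    ultimately show ?case by simp
  qed (use q in simp)
  have "(\<lambda>n. (1/4) ^ n * norm q) \<longlonglongrightarrow> 0"
    by (intro tendsto_mult_left_zero LIMSEQ_realpow_zero) auto
  then have "(\<lambda>n. (\<Lambda> ^^ n) q) \<longlonglongrightarrow> 0"
    by (rule Lim_null_comparison[rotated]) (use orbit in auto)
  moreover have "closed B0"
    using compact_piece[of False] by (auto simp: base_piece_def intro: compact_imp_closed)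
  ultimately have "0 \<in> B0"
    using orbit closed_sequentially[of B0 "\<lambda>n. (\<Lambda> ^^ n) q" 0] by simp
  then show ?thesis by (simp add: base_union_def base_piece_def zero_prod_def)
qed

text \<open>
  All prefixes of \<open>w\<close> of length greater than \<open>m\<close> send the origin into the level-\<open>m\<close> piece given by
  the first \<open>m + 1\<close> digits of \<open>w\<close>. These pieces shrink exponentially, so the sequence is Cauchy.
\<close>
lemma tau_tendsto: "(\<lambda>n. \<Psi> (map w [0..<n]) (0, 0)) \<longlonglongrightarrow> \<tau> w"
proof -
  define x where "x n = \<Psi> (map w [0..<n]) (0, 0)" for n
  obtain C \<theta> where \<theta>: "0 < \<theta>" "\<theta> < 1"
    and C: "\<And>u v. diameter (\<Psi> u ` B v) \<le> C * \<theta> ^ length u"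
    using pieces_shrink by blast
  have x_in: "x n \<in> \<Psi> (map w [0..<m]) ` B (w m)" if "n > m" for m n
  proof -
    have "[0..<n] = [0..<m] @ m # [Suc m..<n]"
      using that upt_add_eq_append[of 0 m "n - m"] by (simp add: upt_conv_Cons)
    then have "x n = \<Psi> (map w [0..<m]) (\<psi> (w m) (\<Psi> (map w [Suc m..<n]) (0, 0)))"
      by (simp add: x_def Psi_append)
    then show ?thesis
      using psi_in_piece Psi_in_base_union zero_in_base_union by blast
  qed
  have "Cauchy x"
  proof (rule metric_CauchyI)
    fix e :: real assume e: "e > 0"
    have "(\<lambda>m. C * \<theta> ^ m) \<longlonglongrightarrow> 0"
      using \<theta> by (intro tendsto_mult_right_zero LIMSEQ_realpow_zero) auto
    then obtain m where m: "C * \<theta> ^ m < e"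
      using order_tendstoD(2)[OF _ e] by (fastforce simp: eventually_sequentially)
    have "dist (x n) (x n') < e" if "n \<ge> Suc m" "n' \<ge> Suc m" for n n'
    proof -
      \<comment> \<open>For an unbounded set the diameter would be a default value that bounds no distance.\<close>
      have "bounded (\<Psi> (map w [0..<m]) ` B (w m))"
        by (intro compact_imp_bounded compact_continuous_image compact_piece
            continuous_on_subset[OF continuous_on_Psi piece_subset_base_union])
      then have "dist (x n) (x n') \<le> diameter (\<Psi> (map w [0..<m]) ` B (w m))"
        using that by (intro diameter_bounded_bound x_in) auto
      then show ?thesis using C[of "map w [0..<m]" "w m"] m by simp
    qed
    then show "\<exists>M. \<forall>m\<ge>M. \<forall>n\<ge>M. dist (x m) (x n) < e" by blast
  qed
  then have "x \<longlonglongrightarrow> lim x" using Cauchy_convergent convergent_LIMSEQ_iff by blast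
  then show ?thesis by (simp add: x_def[abs_def] tau_def)
qed

lemma tau_in_base_union: "\<tau> w \<in> base_union"
  using closed_sequentially[OF compact_imp_closed[OF compact_base_union] _ tau_tendsto]
    Psi_in_base_union[OF zero_in_base_union] by blast

text \<open>Self-similarity of the coding: the first digit is the outermost branch.\<close>
lemma tau_unfold: "\<tau> w = \<psi> (w 0) (\<tau> (\<lambda>k. w (Suc k)))"
proof -
  let ?x = "\<lambda>n. \<Psi> (map (\<lambda>k. w (Suc k)) [0..<n]) (0, 0)"
  have "(\<lambda>n. \<psi> (w 0) (?x n)) \<longlonglongrightarrow> \<psi> (w 0) (\<tau> (\<lambda>k. w (Suc k)))"
    by (rule continuous_on_tendsto_compose[OF continuous_on_psi tau_tendsto tau_in_base_union])
      (use Psi_in_base_union[OF zero_in_base_union] in auto)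
  moreover have "\<psi> (w 0) (?x n) = \<Psi> (map w [0..<Suc n]) (0, 0)" for n
    by (simp del: upt_Suc add: upt_conv_Cons map_Suc_upt[symmetric] comp_def)
  ultimately have "(\<lambda>n. \<Psi> (map w [0..<Suc n]) (0, 0)) \<longlonglongrightarrow> \<psi> (w 0) (\<tau> (\<lambda>k. w (Suc k)))"
    by simp
  moreover have "(\<lambda>n. \<Psi> (map w [0..<Suc n]) (0, 0)) \<longlonglongrightarrow> \<tau> w"
    using tau_tendsto by (rule LIMSEQ_Suc)
  ultimately show ?thesis using LIMSEQ_unique by blast
qed

lemma tau_Cons: "\<tau> (case_nat i w) = \<psi> i (\<tau> w)"
  using tau_unfold[of "case_nat i w"] by simp

section \<open>The dynamics on the Cantor set is the adding machine\<close>

lemma adding_machine_Cons_False: "adding_machine (case_nat False w) = case_nat True w"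
  by (auto simp: adding_machine_def fun_eq_iff split: nat.split)

lemma adding_machine_Cons_True: "adding_machine (case_nat True w) = case_nat False (adding_machine w)"
proof
  fix k show "adding_machine (case_nat True w) k = case_nat False (adding_machine w) k"
    by (cases k) (auto simp: adding_machine_def less_Suc_eq_0_disj)
qed

lemma word_cases:
  obtains v where "w = case_nat False v" | v where "w = case_nat True v"
proof -
  have "w = case_nat (w 0) (\<lambda>k. w (Suc k))" by (simp add: fun_eq_iff split: nat.split)
  then show thesis using that by (cases "w 0") metis+
qed

lemma F_F_Lam: "q \<in> base_union \<Longrightarrow> F (F (\<Lambda> q)) = \<Lambda> (F q)"
  using base_union_subset_D Lam_in_piece[of q] psi_in_piece[of q True] pieces_in_D
  by (intro F_renormalization) (auto simp: psi_def)

text \<open>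
  Adding \<open>1\<close> to a word that starts with \<open>0\<close> changes this digit to \<open>1\<close>, which matches
  \<open>F \<circ> \<psi>\<^sub>0 = \<psi>\<^sub>1\<close>. If the word starts with \<open>1\<close>, a carry moves on to the rest of the word; on the side
  of the points, \<open>F \<circ> \<psi>\<^sub>1 = \<Lambda> \<circ> F\<close>, so the discrepancy of the two sides is the \<open>\<Lambda>\<close>-image of the
  discrepancy for the shifted word. It is thus reduced by the factor \<open>1/4\<close> at each carry; being bounded
  uniformly in the word, it vanishes, also for the word \<open>111\<dots>\<close> with infinitely many carries.
\<close>
lemma F_tau: "F (\<tau> w) = \<tau> (adding_machine w)"
proof -
  have "bounded (F ` base_union)" "bounded base_union"
    by (intro compact_imp_bounded compact_continuous_image compact_base_union continuous_F base_union_subset_D)+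
  then obtain M1 M2 where "\<And>p. p \<in> F ` base_union \<Longrightarrow> norm p \<le> M1" "\<And>p. p \<in> base_union \<Longrightarrow> norm p \<le> M2"
    unfolding bounded_iff by blast
  then have M: "norm (F (\<tau> w) - \<tau> (adding_machine w)) \<le> M1 + M2" for w
    using tau_in_base_union by (meson add_mono imageI norm_triangle_ineq4 order_trans)
  have "norm (F (\<tau> w) - \<tau> (adding_machine w)) \<le> (1/4) ^ n * (M1 + M2)" for n w
  proof (induction n arbitrary: w)
    case (Suc n)
    show ?case
    proof (cases w rule: word_cases)
      case (1 v)
      have "0 \<le> M1 + M2" using M[of w] norm_ge_zero order_trans by blast
      then show ?thesis
        by (simp add: 1 adding_machine_Cons_False tau_Cons psi_def)
    next
      case (2 v)
      have "F (\<tau> w) - \<tau> (adding_machine w) = \<Lambda> (F (\<tau> v) - \<tau> (adding_machine v))"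
        using linear_Lam[THEN bounded_linear.linear]
        by (simp add: 2 adding_machine_Cons_True tau_Cons psi_def F_F_Lam tau_in_base_union linear_diff)
      then show ?thesis
        using norm_Lam_le[of "F (\<tau> v) - \<tau> (adding_machine v)"] Suc[of v] by simp
    qed
  qed (use M in simp)
  moreover have "(\<lambda>n. (1/4) ^ n * (M1 + M2)) \<longlonglongrightarrow> 0"
    by (intro tendsto_mult_left_zero LIMSEQ_realpow_zero) auto
  ultimately have "norm (F (\<tau> w) - \<tau> (adding_machine w)) \<le> 0"
    by (intro LIMSEQ_le_const) auto
  then show ?thesis by simp
qed

lemma funpow_F_tau: "(F ^^ k) (\<tau> w) = \<tau> ((adding_machine ^^ k) w)"
  by (induction k) (simp_all add: F_tau)

section \<open>Derivatives of iterates and renormalization\<close>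

lemma funpow_F_has_derivative:
  "((F ^^ k) has_derivative Deriv (F ^^ k) (\<tau> w)) (at (\<tau> w))"
proof -
  have "(F ^^ k) differentiable (at (\<tau> w))"
  proof (induction k)
    case (Suc k)
    have "F differentiable (at ((F ^^ k) (\<tau> w)))"
      using F_has_derivative tau_in_base_union base_union_subset_D by (metis differentiableI funpow_F_tau subsetD)
    from differentiable_chain_at[OF Suc this] show ?case by (simp del: o_apply)
  qed simp
  then show ?thesis by (simp add: frechet_derivative_works)
qed

lemma Deriv_funpow_add:
  "Deriv (F ^^ (j + k)) (\<tau> w) h =
     Deriv (F ^^ j) (\<tau> ((adding_machine ^^ k) w)) (Deriv (F ^^ k) (\<tau> w) h)"
proof -
  have "((F ^^ j) \<circ> (F ^^ k) has_derivative
      Deriv (F ^^ j) ((F ^^ k) (\<tau> w)) \<circ> Deriv (F ^^ k) (\<tau> w)) (at (\<tau> w))"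
    by (rule diff_chain_at[OF funpow_F_has_derivative])
      (use funpow_F_has_derivative[of j] in \<open>simp add: funpow_F_tau\<close>)
  then have "Deriv (F ^^ (j + k)) (\<tau> w) =
      Deriv (F ^^ j) ((F ^^ k) (\<tau> w)) \<circ> Deriv (F ^^ k) (\<tau> w)"
    unfolding funpow_add by (rule frechet_derivative_at[symmetric])
  then show ?thesis by (simp add: funpow_F_tau)
qed

lemma Deriv_funpow_0: "Deriv (F ^^ 0) q h = h"
  by (simp add: frechet_derivative_id)

lemma Deriv_funpow_Suc:
  "Deriv (F ^^ Suc k) (\<tau> w) h =
     Deriv F (\<tau> ((adding_machine ^^ k) w)) (Deriv (F ^^ k) (\<tau> w) h)"
  using Deriv_funpow_add[of 1 k w h] by (simp del: o_apply)

lemma area_form_Deriv: "q \<in> D \<Longrightarrow> area_form (Deriv F q u) (Deriv F q v) = area_form u v"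
  using F_exact_symplectic unfolding exact_symplectic_on_def by blast

lemma area_form_Deriv_funpow:
  "area_form (Deriv (F ^^ k) (\<tau> w) u) (Deriv (F ^^ k) (\<tau> w) v) = area_form u v"
proof (induction k)
  case 0
  then show ?case by (simp only: Deriv_funpow_0)
next
  case (Suc k)
  have "\<tau> ((adding_machine ^^ k) w) \<in> D" using tau_in_base_union base_union_subset_D by blast
  then show ?case
    unfolding Deriv_funpow_Suc using Suc by (simp only: area_form_Deriv)
qed

lemma adding_machine_even_Cons:
  "(adding_machine ^^ (2 * m)) (case_nat False w) = case_nat False ((adding_machine ^^ m) w)"
  by (induction m)
    (simp_all add: adding_machine_Cons_False adding_machine_Cons_True cong del: nat.case_cong_weak)

text \<open>
  The derivative of \<open>F \<circ> F \<circ> \<Lambda> = \<Lambda> \<circ> F\<close>. The equation may be differentiated at points of the Cantor set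
  because its domain conditions are open and hold there.
\<close>
lemma Deriv_F_F_Lam:
  "Deriv (F ^^ 2) (\<tau> (case_nat False w)) (\<Lambda> h) = \<Lambda> (Deriv F (\<tau> w) h)"
proof -
  let ?q = "\<tau> w"
  have q: "?q \<in> D" "\<Lambda> ?q \<in> D" "F (\<Lambda> ?q) \<in> D"
    using tau_in_base_union[of w] base_union_subset_D Lam_in_piece[of ?q] psi_in_piece[of ?q True] pieces_in_D
    by (auto simp: psi_def)
  have L: "(\<Lambda> has_derivative \<Lambda>) (at q)" for q
    using linear_Lam by (rule bounded_linear_imp_has_derivative)
  have "((F ^^ 2) has_derivative Deriv (F ^^ 2) (\<Lambda> ?q)) (at (\<Lambda> ?q))"
    using funpow_F_has_derivative[of 2 "case_nat False w"] by (simp add: tau_Cons psi_def)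
  from diff_chain_at[OF L this]
  have 1: "((F ^^ 2) \<circ> \<Lambda> has_derivative Deriv (F ^^ 2) (\<Lambda> ?q) \<circ> \<Lambda>) (at ?q)" .
  have 2: "(\<Lambda> \<circ> F has_derivative \<Lambda> \<circ> Deriv F ?q) (at ?q)"
    by (rule diff_chain_at[OF F_has_derivative[OF q(1)] L])
  have ev: "\<forall>\<^sub>F q in nhds ?q. f q \<in> D" if "isCont f ?q" "f ?q \<in> D" for f :: "real \<times> real \<Rightarrow> real \<times> real"
    using that open_D by (metis isCont_def tendsto_at_iff_tendsto_nhds topological_tendstoD)
  have contL: "isCont \<Lambda> ?q"
    using L by (rule has_derivative_continuous)
  have contFL: "isCont (\<lambda>q. F (\<Lambda> q)) ?q"
    using isCont_o2[OF contL has_derivative_continuous[OF F_has_derivative[OF q(2)]]] .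
  have "\<forall>\<^sub>F q in nhds ?q. (\<Lambda> \<circ> F) q = ((F ^^ 2) \<circ> \<Lambda>) q"
    using ev[OF continuous_ident q(1)] ev[OF contL q(2)] ev[OF contFL q(3)]
    by eventually_elim (simp add: numeral_2_eq_2 F_renormalization)
  then obtain S where S: "open S" "?q \<in> S" "\<And>q. q \<in> S \<Longrightarrow> (\<Lambda> \<circ> F) q = ((F ^^ 2) \<circ> \<Lambda>) q"
    unfolding eventually_nhds by blast
  have "((F ^^ 2) \<circ> \<Lambda> has_derivative \<Lambda> \<circ> Deriv F ?q) (at ?q)"
    by (rule has_derivative_transform_within_open[OF 2 S])
  from fun_cong[OF has_derivative_unique[OF 1 this], of h] show ?thesis
    by (simp add: tau_Cons psi_def)
qed

text \<open>
  In the induction, the points \<open>F\<^sup>2\<^sup>m(\<Lambda>(\<tau> w))\<close> and \<open>\<Lambda>(F\<^sup>m(\<tau> w))\<close> agree because adding \<open>2 m\<close> to a word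
  with first digit \<open>0\<close> adds \<open>m\<close> to its remaining digits.
\<close>
lemma Deriv_even_funpow_Lam:
  "Deriv (F ^^ (2 * m)) (\<tau> (case_nat False w)) (\<Lambda> h) = \<Lambda> (Deriv (F ^^ m) (\<tau> w) h)"
proof (induction m)
  case 0
  then show ?case by (simp only: Deriv_funpow_0 mult_0_right)
next
  case (Suc m)
  have "Deriv (F ^^ (2 * Suc m)) (\<tau> (case_nat False w)) (\<Lambda> h)
      = Deriv (F ^^ 2) (\<tau> (case_nat False ((adding_machine ^^ m) w)))
          (\<Lambda> (Deriv (F ^^ m) (\<tau> w) h))"
    using Deriv_funpow_add[of 2 "2 * m"] Suc by (simp add: adding_machine_even_Cons)
  also have "\<dots> = \<Lambda> (Deriv (F ^^ Suc m) (\<tau> w) h)"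
    by (simp only: Deriv_F_F_Lam Deriv_funpow_Suc)
  finally show ?case .
qed

section \<open>Subexponential growth of the derivatives\<close>

text \<open>
  The constant does not depend on \<open>w\<close>: the halving argument compares the growth at one point with the
  growth at another.
\<close>
definition growth_rate_le :: "real \<Rightarrow> bool" where
  "growth_rate_le a \<longleftrightarrow>
     (\<exists>C\<ge>1. \<forall>w k h. norm (Deriv (F ^^ k) (\<tau> w) h) \<le> C * exp (a * k) * norm h)"

lemma Deriv_F_tau_bounded:
  obtains L where "L \<ge> 1" "\<And>w h. norm (Deriv F (\<tau> w) h) \<le> L * norm h"
  using extends_holomorphically_Deriv_bounded[OF F_holomorphic open_D compact_base_union base_union_subset_D]
    tau_in_base_union by metis

lemma growth_rate_initial: obtains a where "a \<ge> 0" "growth_rate_le a"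
proof -
  obtain L where L: "L \<ge> 1" "\<And>w h. norm (Deriv F (\<tau> w) h) \<le> L * norm h"
    using Deriv_F_tau_bounded by blast
  have "norm (Deriv (F ^^ k) (\<tau> w) h) \<le> L ^ k * norm h" for k w h
  proof (induction k)
    case 0
    then show ?case by (simp only: Deriv_funpow_0) simp
  next
    case (Suc k)
    have "norm (Deriv (F ^^ Suc k) (\<tau> w) h) \<le> L * norm (Deriv (F ^^ k) (\<tau> w) h)"
      unfolding Deriv_funpow_Suc by (rule L(2))
    also have "\<dots> \<le> L * (L ^ k * norm h)" using Suc L(1) by (intro mult_left_mono) auto
    finally show ?case by (simp only: power_Suc mult.assoc)
  qed
  moreover have "L ^ k = exp (ln L * k)" for k
    using L(1) by (simp add: exp_of_nat2_mult)
  ultimately have "growth_rate_le (ln L)"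
    unfolding growth_rate_le_def by (intro exI[of _ 1]) auto
  then show thesis using that[of "ln L"] L(1) by simp
qed

text \<open>
  For a point \<open>\<Lambda> q\<close> and an even time \<open>2 m\<close>, the derivative is \<open>\<Lambda> DF\<^sup>m(q) \<Lambda>\<^sup>-\<^sup>1\<close>. Its size is at most
  \<open>C / \<mu>\<close> times \<open>exp (a m) = exp ((a / 2) (2 m))\<close>. One further iterate at the end makes odd times
  possible, and one at the beginning moves a point coded by a word with first digit \<open>1\<close> into the image of
  \<open>\<Lambda>\<close>; each costs a factor \<open>L\<close>.
\<close>
lemma growth_rate_halve:
  assumes "a \<ge> 0" "growth_rate_le a"
  shows "growth_rate_le (a / 2)"
proof -
  obtain C where C: "C \<ge> 1" "\<And>w k h. norm (Deriv (F ^^ k) (\<tau> w) h) \<le> C * exp (a * k) * norm h"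
    using assms(2) unfolding growth_rate_le_def by blast
  obtain L where L: "L \<ge> 1" "\<And>w h. norm (Deriv F (\<tau> w) h) \<le> L * norm h"
    using Deriv_F_tau_bounded by blast
  define E where "E = C / mu"
  have E: "E \<ge> 1" using C(1) mu_pos mu_le_lam lam_mu_le by (simp add: E_def field_simps)
  have even: "norm (Deriv (F ^^ (2 * m)) (\<tau> (case_nat False v)) h) \<le> E * exp (a / 2 * real (2 * m)) * norm h"
    for v m h
  proof -
    obtain h' where h': "h = \<Lambda> h'" by (rule surj_Lam)
    have "norm (Deriv (F ^^ (2 * m)) (\<tau> (case_nat False v)) h) \<le> norm (Deriv (F ^^ m) (\<tau> v) h')"
      using norm_Lam_le[of "Deriv (F ^^ m) (\<tau> v) h'"] norm_ge_zero[of "Deriv (F ^^ m) (\<tau> v) h'"]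
      unfolding h' Deriv_even_funpow_Lam by linarith
    also have "\<dots> \<le> C * exp (a * m) * norm h'" by (rule C)
    also have "\<dots> \<le> C * exp (a * m) * (norm h / mu)"
      using C(1) norm_Lam_ge[of h'] mu_pos by (intro mult_left_mono) (auto simp: h' field_simps)
    finally show ?thesis by (simp add: E_def)
  qed
  have False_start: "norm (Deriv (F ^^ k) (\<tau> (case_nat False v)) h) \<le> L * E * exp (a / 2 * k) * norm h"
    for v k h
  proof (cases "even k")
    case True
    then obtain m where k: "k = 2 * m" by blast
    have "norm (Deriv (F ^^ k) (\<tau> (case_nat False v)) h) \<le> 1 * (E * exp (a / 2 * k) * norm h)"
      unfolding k using even by simp
    also have "\<dots> \<le> L * (E * exp (a / 2 * k) * norm h)"
      using L(1) E by (intro mult_right_mono) auto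
    finally show ?thesis by (simp add: mult.assoc)
  next
    case False
    then obtain m where k: "k = 1 + 2 * m" by (metis oddE add.commute)
    have "norm (Deriv (F ^^ k) (\<tau> (case_nat False v)) h)
        \<le> L * norm (Deriv (F ^^ (2 * m)) (\<tau> (case_nat False v)) h)"
      unfolding k Deriv_funpow_add using L(2) by simp
    also have "\<dots> \<le> L * (E * exp (a / 2 * real (2 * m)) * norm h)"
      using L(1) even by (intro mult_left_mono) auto
    also have "\<dots> \<le> L * (E * exp (a / 2 * k) * norm h)"
      using L(1) E assms(1)
      by (intro mult_left_mono mult_right_mono) (auto simp: k algebra_simps)
    finally show ?thesis by (simp add: mult.assoc)
  qed
  have "norm (Deriv (F ^^ k) (\<tau> w) h) \<le> L * L * E * exp (a / 2 * k) * norm h" for w k h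
  proof (cases w rule: word_cases)
    case (1 v)
    have "norm (Deriv (F ^^ k) (\<tau> w) h) \<le> 1 * (L * E * exp (a / 2 * k) * norm h)"
      unfolding 1 using False_start by simp
    also have "\<dots> \<le> L * (L * E * exp (a / 2 * k) * norm h)"
      using L(1) E by (intro mult_right_mono) auto
    finally show ?thesis by (simp add: mult.assoc)
  next
    case (2 v)
    show ?thesis
    proof (cases k)
      case 0
      have "1 * norm h \<le> (L * L * E) * norm h"
        using mult_mono[OF mult_mono[OF L(1) L(1)] E] L(1) by (intro mult_right_mono) auto
      then show ?thesis unfolding 0 Deriv_funpow_0 by simp
    next
      case (Suc j)
      have "norm (Deriv (F ^^ k) (\<tau> w) h)
          \<le> L * E * exp (a / 2 * j) * norm (Deriv F (\<tau> w) h)"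
        using False_start[of j "adding_machine v" "Deriv F (\<tau> w) h"] Deriv_funpow_add[of j 1 w h]
        by (simp add: Suc 2 adding_machine_Cons_True)
      also have "\<dots> \<le> L * E * exp (a / 2 * k) * (L * norm h)"
        using L E assms(1) by (intro mult_mono) (auto simp: Suc mult_left_mono)
      finally show ?thesis by (simp add: mult_ac)
    qed
  qed
  moreover have "L * L * E \<ge> 1"
    using mult_mono[OF mult_mono[OF L(1) L(1)] E] L(1) by simp
  ultimately show ?thesis unfolding growth_rate_le_def by blast
qed

lemma growth_rate_subexponential:
  assumes "\<epsilon> > 0" shows "growth_rate_le \<epsilon>"
proof -
  obtain a where a: "a \<ge> 0" "growth_rate_le a" by (rule growth_rate_initial)
  have "growth_rate_le (a / 2 ^ n)" for n
  proof (induction n)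
    case (Suc n)
    then show ?case using growth_rate_halve[of "a / 2 ^ n"] a(1) by (simp add: mult.commute)
  qed (use a in simp)
  moreover have "(\<lambda>n. a * (1 / 2) ^ n) \<longlonglongrightarrow> 0"
    by (intro tendsto_mult_right_zero LIMSEQ_realpow_zero) auto
  then obtain n where "a * (1 / 2) ^ n < \<epsilon>"
    using order_tendstoD(2)[OF _ assms] by (fastforce simp: eventually_sequentially)
  ultimately obtain b C where b: "b < \<epsilon>" "C \<ge> 1"
    "\<And>w k h. norm (Deriv (F ^^ k) (\<tau> w) h) \<le> C * exp (b * k) * norm h"
    unfolding growth_rate_le_def by (metis power_one_over times_divide_eq_right mult.right_neutral)
  have "C * exp (b * k) * norm h \<le> C * exp (\<epsilon> * k) * norm h"
    for k :: nat and h :: "real \<times> real"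
    using b by (intro mult_right_mono mult_left_mono) (auto intro: mult_right_mono)
  then show ?thesis
    unfolding growth_rate_le_def using b(2,3) order_trans by blast
qed

section \<open>The angle between two iterated vectors\<close>

text \<open>
  Let \<open>A\<close> be the area spanned by \<open>u\<close> and \<open>v\<close>, \<open>P\<close> the product of their lengths and \<open>Q\<close> that of the
  lengths of their images. The ratio of sines is \<open>P / Q\<close>. Subexponential growth bounds \<open>Q\<close> from above,
  and invariance of the area bounds it from below by \<open>A\<close>.
\<close>
lemma sin_angle_ratio_tendsto:
  assumes uv: "area_form u v \<noteq> 0"
  shows "(\<lambda>k. 1 / real k *
            ln (sin (angle (Deriv (F ^^ k) (\<tau> w) u) (Deriv (F ^^ k) (\<tau> w) v)) / sin (angle u v)))
         \<longlonglongrightarrow> 0"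
proof (rule LIMSEQ_I)
  fix e :: real assume e: "e > 0"
  let ?r = "\<lambda>k. sin (angle (Deriv (F ^^ k) (\<tau> w) u) (Deriv (F ^^ k) (\<tau> w) v)) / sin (angle u v)"
  define A where "A = \<bar>area_form u v\<bar>"
  have A: "A > 0" using uv by (simp add: A_def)
  define P where "P = norm u * norm v"
  have nz: "x \<noteq> 0 \<and> y \<noteq> 0" if "area_form x y \<noteq> 0" for x y
    using that by (auto simp: area_form_def)
  have P: "P > 0" using nz[OF uv] by (simp add: P_def)
  have AP: "A \<le> P" using abs_area_form_le[of u v] by (simp add: A_def P_def)
  obtain C where C: "C \<ge> 1"
    and growth: "\<And>w k h. norm (Deriv (F ^^ k) (\<tau> w) h) \<le> C * exp (e / 4 * k) * norm h"
    using growth_rate_subexponential[of "e / 4"] e unfolding growth_rate_le_def by auto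
  \<comment> \<open>The first term pays for the upper bound on \<open>Q\<close>, the second for the lower bound \<open>A \<le> Q\<close>.\<close>
  define c where "c = 2 * ln C + ln (P / A)"
  have bound: "\<bar>ln (?r k)\<bar> \<le> c + e / 2 * k" for k
  proof -
    let ?u = "Deriv (F ^^ k) (\<tau> w) u" and ?v = "Deriv (F ^^ k) (\<tau> w) v"
    define Q where "Q = norm ?u * norm ?v"
    have area: "area_form ?u ?v = area_form u v" by (rule area_form_Deriv_funpow)
    have uv': "?u \<noteq> 0" "?v \<noteq> 0" using nz[of ?u ?v] uv area by auto
    have Q: "Q > 0" using uv' by (simp add: Q_def)
    have "A \<le> Q" using abs_area_form_le[of ?u ?v] by (simp add: A_def Q_def area)
    have "Q \<le> (C * exp (e / 4 * k) * norm u) * (C * exp (e / 4 * k) * norm v)"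
      unfolding Q_def using growth C by (intro mult_mono) auto
    also have "\<dots> = C\<^sup>2 * exp (e / 2 * k) * P"
      by (simp add: P_def power2_eq_square mult_ac flip: exp_add)
    finally have QP: "Q \<le> C\<^sup>2 * exp (e / 2 * k) * P" .
    have "?r k = P / Q"
      using nz[OF uv] uv uv' by (simp add: sin_angle area P_def Q_def)
    then have r: "ln (?r k) = ln P - ln Q" using P Q by (simp add: ln_div)
    have "ln Q \<le> ln (C\<^sup>2 * exp (e / 2 * k) * P)"
      using QP Q by simp
    also have "\<dots> = 2 * ln C + e / 2 * k + ln P"
      using C P by (simp add: ln_mult ln_realpow)
    finally have "ln Q \<le> 2 * ln C + e / 2 * k + ln P" .
    moreover have "ln A \<le> ln Q" "ln A \<le> ln P" using \<open>A \<le> Q\<close> AP A Q P by auto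
    moreover have "0 \<le> ln C" "0 \<le> e / 2 * k" using C e by auto
    moreover have "ln (P / A) = ln P - ln A" using A P by (simp add: ln_div)
    ultimately show ?thesis
      unfolding r c_def by linarith
  qed
  obtain N :: nat where N: "2 * c / e < N" using reals_Archimedean2 by blast
  have "\<bar>1 / real k * ln (?r k)\<bar> < e" if "k \<ge> Suc N" for k
  proof -
    have k: "real k > 0" "2 * c / e < k" using that N by auto
    have "\<bar>1 / real k * ln (?r k)\<bar> = \<bar>ln (?r k)\<bar> / k" by (simp add: abs_mult)
    also have "\<dots> \<le> (c + e / 2 * k) / k" using bound by (intro divide_right_mono) auto
    also have "\<dots> < e" using k e by (simp add: field_simps)
    finally show ?thesis .
  qed
  then show "\<exists>N. \<forall>k\<ge>N. norm (1 / real k * ln (?r k) - 0) < e" by auto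
qed

end

theorem proposition7p4:
  fixes D Ds B0 :: "(real \<times> real) set"
    and F :: "real \<times> real \<Rightarrow> real \<times> real"
    and lam mu :: real
    and s z :: "real \<Rightarrow> real \<Rightarrow> real"
    and eta :: "((real \<times> real) set \<times> (nat \<Rightarrow> bool)) measure"
    and etaw :: "(nat \<Rightarrow> bool) \<Rightarrow> (real \<times> real) set measure"
  assumes "ekw_pieces D F lam mu Ds s z B0"
    and "sets eta = sets (RP1_borel \<Otimes>\<^sub>M bernoulli_measure)"
    and "ergodic_invariant eta (Phi F lam mu)"
    and "disintegration eta etaw"
  shows "AE \<rho> in bernoulli_measure. \<exists>N \<in> null_sets (etaw \<rho>). \<forall>u v.
           u \<noteq> v \<and> independent {u, v} \<and> span {u} \<notin> N \<and> span {v} \<notin> N \<longrightarrow>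
           (\<lambda>k. 1 / real k *
              ln (sin (angle (Deriv (F ^^ k) (tau F lam mu \<rho>) u) (Deriv (F ^^ k) (tau F lam mu \<rho>) v))
                  / sin (angle u v)))
           \<longlonglongrightarrow> 0"
proof -
  interpret ekw_pieces D F lam mu Ds s z B0 by fact
  show ?thesis
    \<comment> \<open>The empty set serves as the set of exceptional directions at every point.\<close>
    by (intro AE_I2 bexI[of _ "{}"] allI impI sin_angle_ratio_tendsto)
      (simp_all add: independent_imp_area_form_nonzero)
qed

end
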